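(* Let $r,k$ be integers with $0\le r<k$, let $p\ge1$ be an integer, let $1\le i_1\le i_2\le\cdots\le i_p$ be integers, and let $x_1,\ldots,x_p\in\{1,-1\}$. Then \[\begin{aligned} &(k-r)\sum_{n=1}^\infty\frac{\prod_{j=1}^p\zeta_n(i_j;x_j)-\zeta_n(i_1+\cdots+i_p;\,x_1\cdots x_p)}{(n+r)(n+k)}\\ &=-\sum_{i=1}^{k-r}\sum_{n=1}^\infty\frac{x_1^n\cdots x_p^n}{n^{i_1+\cdots+i_p}(n+r+i-1)}\\ &\quad-\sum_{i=1}^{k-r}\sum_{n=1}^\infty\left\{\sum_{j=0}^{p-1}\ \sum_{1\le l_1<\cdots<l_j\le p}(-1)^{p-j}\frac{\prod_{b=1}^j\zeta_n(i_{l_b};x_{l_b})}{n^{\,i_1+\cdots+i_p-(i_{l_1}+\cdots+i_{l_j})}(n+r+i-1)}\cdot\frac{\prod_{a=1}^px_a^n}{\prod_{b=1}^jx_{l_b}^n}\right\}, \end{aligned}\] where for $j=0$ the inner sum consists of the single term with empty products equal to $1$.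
   Context: For positive integers $n,m$ and $c\in\mathbb C$, $\zeta_n(m;c)=\sum_{q=1}^n c^q/q^m$. *)

theory Defs
  imports Complex_Main "HOL-Library.FuncSet"
begin

definition zeta_partial :: "nat \<Rightarrow> nat \<Rightarrow> complex \<Rightarrow> complex" where
  "zeta_partial n m c = (\<Sum>q=1..n. c ^ q / of_nat q ^ m)"

text \<open>The index tuples \<open>1 \<le> l\<^sub>1 < \<dots> < l\<^sub>j \<le> p\<close>. Extensionality makes each tuple
  be represented by exactly one function; for \<open>j = 0\<close> only the empty tuple remains.\<close>

definition incr_tuples :: "nat \<Rightarrow> nat \<Rightarrow> (nat \<Rightarrow> nat) set" where
  "incr_tuples j p = {l \<in> {1..j} \<rightarrow>\<^sub>E {1..p}. strict_mono_on {1..j} l}"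

end

theory Submission
  imports Defs "HOL-Analysis.Harmonic_Numbers" "HOL-Real_Asymp.Real_Asymp"
begin

text \<open>
  Let \<open>D n\<close> be the numerator of the series on the left. Since
  \<open>\<zeta>\<^bsub>n-1\<^esub>(i;x) = \<zeta>\<^bsub>n\<^esub>(i;x) - x\<^sup>n/n\<^sup>i\<close>, expanding the product over subsets of \<open>{1..p}\<close> shows
  that \<open>D (n-1) - D n\<close> is the sum of the numerators of \<open>G\<close> and \<open>H\<close>; the full subset cancels
  \<open>\<Prod>\<^sub>j \<zeta>\<^sub>n(i\<^sub>j;x\<^sub>j)\<close>. On the other hand \<open>(k-r)/((n+r)(n+k))\<close> telescopes into
  \<open>\<Sum>\<^sub>t (1/(n+r+t-1) - 1/(n+r+t))\<close>, so the identity is summation by parts for each \<open>t\<close>. The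
  boundary term vanishes because \<open>D\<close> grows at most like a power of \<open>ln n\<close>, hence
  \<open>D n = O(\<surd>n)\<close>. Convergence of \<open>H\<close> comes out of the summation by parts as well, given that
  \<open>G\<close> converges absolutely.
\<close>

section \<open>Summation by parts\<close>

lemma summation_by_parts:
  fixes D u :: "nat \<Rightarrow> 'a::comm_ring_1"
  assumes "D 0 = 0"
  shows "(\<Sum>n<N. (D (Suc n) - D n) * u (Suc n))
         = (\<Sum>n<N. D (Suc n) * (u (Suc n) - u (Suc (Suc n)))) + D N * u (Suc N)"
  using assms by (induction N) (auto simp: algebra_simps)

text \<open>Convergence on the left is part of the conclusion: its partial sums differ from those of
  the summable series only by a boundary term tending to 0.\<close>

lemma sums_by_parts:
  fixes D u :: "nat \<Rightarrow> 'a::real_normed_field"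
  assumes "D 0 = 0" "(\<lambda>N. D N * u (Suc N)) \<longlonglongrightarrow> 0"
    and "summable (\<lambda>n. D (Suc n) * (u (Suc n) - u (Suc (Suc n))))"
  shows "(\<lambda>n. (D (Suc n) - D n) * u (Suc n)) sums
         (\<Sum>n. D (Suc n) * (u (Suc n) - u (Suc (Suc n))))"
  using tendsto_add[OF summable_LIMSEQ[OF assms(3)] assms(2)]
  by (simp add: sums_def summation_by_parts[where D = D, OF assms(1)])

section \<open>Logarithmic growth of the partial zeta sums\<close>

lemma zeta_partial_Suc:
  "zeta_partial (Suc n) m c = zeta_partial n m c + c ^ Suc n / of_nat (Suc n) ^ m"
  by (simp add: zeta_partial_def)

lemma zeta_partial_0 [simp]: "zeta_partial 0 m c = 0"
  by (simp add: zeta_partial_def)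

text \<open>Termwise comparison, in which exponent 1 is the worst case.\<close>

lemma norm_zeta_partial_le_harm:
  assumes "norm c \<le> 1" "1 \<le> m"
  shows "norm (zeta_partial n m c) \<le> harm n"
  unfolding zeta_partial_def harm_def
proof (rule sum_norm_le)
  fix q assume q: "q \<in> {1..n}"
  have "norm (c ^ q / of_nat q ^ m) \<le> 1 / real q ^ m"
    using q assms by (simp add: norm_divide norm_power divide_right_mono power_le_one)
  also have "\<dots> \<le> 1 / real q ^ 1"
    using q assms by (intro divide_left_mono power_increasing) auto
  finally show "norm (c ^ q / of_nat q ^ m) \<le> inverse (of_nat q)"
    by (simp add: inverse_eq_divide)
qed

text \<open>The difference from the logarithm converges to the Euler-Mascheroni constant, so it is
  bounded.\<close>

lemma harm_bigo_ln: "(harm :: nat \<Rightarrow> real) \<in> O(\<lambda>n. ln (real n))"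
proof -
  have "(\<lambda>n. harm n - ln (real n) :: real) \<in> O(\<lambda>_. 1)"
    using euler_mascheroni_LIMSEQ by (intro bigoI_tendsto[where c = euler_mascheroni]) auto
  moreover have "(\<lambda>_. 1) \<in> O(\<lambda>n. ln (real n))" by real_asymp
  ultimately have "(\<lambda>n. harm n - ln (real n) :: real) \<in> O(\<lambda>n. ln (real n))"
    by (rule landau_o.big_trans)
  from sum_in_bigo(1)[OF this, of "\<lambda>n. ln (real n)"] show ?thesis by simp
qed

lemma zeta_partial_bigo_ln:
  assumes "norm c \<le> 1" "1 \<le> m"
  shows "(\<lambda>n. zeta_partial n m c) \<in> O(\<lambda>n. of_real (ln (real n)))"
proof -
  have "(\<lambda>n. norm (zeta_partial n m c)) \<in> O(\<lambda>n. harm n :: real)"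
    using norm_zeta_partial_le_harm[OF assms] by (intro bigoI[of _ 1]) (simp add: harm_nonneg)
  also note harm_bigo_ln
  finally show ?thesis by (simp add: bigo_def)
qed

section \<open>Increasing tuples as subsets, and the expansion of a product\<close>

lemma image_incr_tuples:
  assumes "S \<subseteq> {1..p}" "card S = j"
  obtains l where "l \<in> incr_tuples j p" "l ` {1..j} = S"
proof -
  from assms have "finite S" by (meson finite_atLeastAtMost finite_subset)
  define xs where "xs = sorted_list_of_set S"
  \<comment> \<open>List positions start at 0 and tuple indices at 1, hence \<open>b - 1\<close>;
    \<open>restrict\<close> supplies extensionality.\<close>
  define l where "l = restrict (\<lambda>b. xs ! (b - 1)) {1..j}"
  have xs: "sorted_wrt (<) xs" "length xs = j" "set xs = S"
    using \<open>finite S\<close> assms by (auto simp: xs_def)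
  have im: "l ` {1..j} = S"
  proof -
    have "{1..j} = Suc ` {..<j}" by (simp add: image_Suc_lessThan)
    hence "l ` {1..j} = (\<lambda>b. xs ! b) ` {..<j}" by (force simp: l_def image_iff)
    also have "\<dots> = S" using xs by (auto simp: set_conv_nth)
    finally show ?thesis .
  qed
  moreover have "strict_mono_on {1..j} l"
    using xs(2) by (fastforce simp: strict_mono_on_def l_def intro: sorted_wrt_nth_less[OF xs(1)])
  moreover have "l \<in> {1..j} \<rightarrow>\<^sub>E {1..p}"
    using im assms by (auto simp: l_def)
  ultimately show ?thesis using that by (simp add: incr_tuples_def)
qed

lemma incr_tuples_inj_on:
  assumes "l \<in> incr_tuples j p"
  shows "inj_on l {1..j}"
  using assms by (auto simp: incr_tuples_def intro: strict_mono_on_imp_inj_on)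

text \<open>An increasing tuple is the sorted enumeration of its range. Injectivity holds because
  strictly sorted lists with the same elements coincide, and extensionality fixes the values outside
  \<open>{1..j}\<close>.\<close>

lemma bij_betw_incr_tuples:
  "bij_betw (\<lambda>l. l ` {1..j}) (incr_tuples j p) {S. S \<subseteq> {1..p} \<and> card S = j}"
  unfolding bij_betw_def
proof
  show "inj_on (\<lambda>l. l ` {1..j}) (incr_tuples j p)"
  proof (rule inj_onI)
    fix l l' assume l: "l \<in> incr_tuples j p" "l' \<in> incr_tuples j p" "l ` {1..j} = l' ` {1..j}"
    have *: "sorted_wrt (<) (map f [1..<Suc j])" if "f \<in> incr_tuples j p" for f
      using that by (simp add: incr_tuples_def sorted_wrt_iff_nth_less strict_mono_on_def del: upt_Suc)
    have "set (map l [1..<Suc j]) = set (map l' [1..<Suc j])"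
      using l(3) by (simp add: atLeastLessThanSuc_atLeastAtMost del: upt_Suc)
    hence "map l [1..<Suc j] = map l' [1..<Suc j]"
      using *[OF l(1)] *[OF l(2)] by (meson strict_sorted_equal)
    hence "\<forall>b\<in>{1..j}. l b = l' b"
      by (simp add: atLeastLessThanSuc_atLeastAtMost del: upt_Suc)
    thus "l = l'" using l(1,2) by (auto simp: incr_tuples_def intro: PiE_ext)
  qed
  show "(\<lambda>l. l ` {1..j}) ` incr_tuples j p = {S. S \<subseteq> {1..p} \<and> card S = j}"
  proof (intro equalityI subsetI)
    fix S assume "S \<in> (\<lambda>l. l ` {1..j}) ` incr_tuples j p"
    thus "S \<in> {S. S \<subseteq> {1..p} \<and> card S = j}"
      using incr_tuples_inj_on by (auto simp: card_image) (auto simp: incr_tuples_def)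
  next
    fix S assume "S \<in> {S. S \<subseteq> {1..p} \<and> card S = j}"
    thus "S \<in> (\<lambda>l. l ` {1..j}) ` incr_tuples j p"
      using image_incr_tuples[of S p j] by (metis (mono_tags, lifting) imageI mem_Collect_eq)
  qed
qed

lemma sum_incr_tuples:
  fixes f :: "nat set \<Rightarrow> 'a::comm_monoid_add"
  shows "(\<Sum>l\<in>incr_tuples j p. f (l ` {1..j})) = (\<Sum>S | S \<subseteq> {1..p} \<and> card S = j. f S)"
  using bij_betw_incr_tuples by (rule sum.reindex_bij_betw)

text \<open>A subset \<open>S\<close> records the factors that contribute \<open>f\<close>; the
  others contribute \<open>- g\<close>, whence the sign.\<close>

lemma prod_diff_incr_tuples:
  fixes f g :: "nat \<Rightarrow> 'a::comm_ring_1"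
  assumes "1 \<le> p"
  shows "(\<Prod>j=1..p. f j - g j) - (\<Prod>j=1..p. f j)
         = (\<Sum>j=0..p-1. \<Sum>l\<in>incr_tuples j p.
              (-1) ^ (p - j) * (\<Prod>b\<in>l ` {1..j}. f b) * (\<Prod>b\<in>{1..p} - l ` {1..j}. g b))"
proof -
  define T where "T S = (-1) ^ (p - card S) * prod f S * prod g ({1..p} - S)" for S
  have "(\<Prod>j=1..p. f j - g j) = (\<Prod>j=1..p. f j + (- g j))" by simp
  also have "\<dots> = (\<Sum>S\<in>Pow {1..p}. prod f S * (\<Prod>b\<in>{1..p} - S. - g b))"
    by (rule prod_add) simp
  also have "\<dots> = (\<Sum>S\<in>Pow {1..p}. T S)"
    by (intro sum.cong) (auto simp: T_def prod_uminus card_Diff_subset finite_subset mult_ac)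
  also have "\<dots> = (\<Sum>j\<in>{0..p}. \<Sum>S\<in>{S\<in>Pow {1..p}. card S = j}. T S)"
    by (rule sum.group[symmetric]) (auto dest: card_mono[rotated])
  \<comment> \<open>The top cardinality belongs to the full set alone. With \<open>1 \<le> p\<close>
    the index \<open>p\<close> lies outside \<open>{0..p-1}\<close>, so it splits off
    cleanly.\<close>
  also have "{0..p} = insert p {0..p-1}" using assms by auto
  also have "(\<Sum>j\<in>insert p {0..p-1}. \<Sum>S\<in>{S\<in>Pow {1..p}. card S = j}. T S)
    = (\<Sum>S\<in>{S\<in>Pow {1..p}. card S = p}. T S)
      + (\<Sum>j=0..p-1. \<Sum>S\<in>{S\<in>Pow {1..p}. card S = j}. T S)"
    using assms by (intro sum.insert) auto
  also have "{S\<in>Pow {1..p}. card S = p} = {{1..p}}"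
    using card_subset_eq[of "{1..p}"] by auto
  finally have "(\<Prod>j=1..p. f j - g j) - prod f {1..p}
      = (\<Sum>j=0..p-1. \<Sum>S | S \<subseteq> {1..p} \<and> card S = j. T S)"
    by (simp add: T_def)
  also have "\<dots> = (\<Sum>j=0..p-1. \<Sum>l\<in>incr_tuples j p. T (l ` {1..j}))"
    by (simp only: sum_incr_tuples)
  also have "\<dots> = (\<Sum>j=0..p-1. \<Sum>l\<in>incr_tuples j p.
              (-1) ^ (p - j) * (\<Prod>b\<in>l ` {1..j}. f b) * (\<Prod>b\<in>{1..p} - l ` {1..j}. g b))"
    by (intro sum.cong refl) (simp only: T_def card_image[OF incr_tuples_inj_on]
        card_atLeastAtMost diff_Suc_1)
  finally show ?thesis .
qed

theorem theorem3p12: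
  fixes r k p :: nat and i :: "nat \<Rightarrow> nat" and x :: "nat \<Rightarrow> complex"
  assumes "r < k" and "1 \<le> p"
    and "\<And>j. j \<in> {1..p} \<Longrightarrow> 1 \<le> i j"
    and "mono_on {1..p} i"
    and "\<And>j. j \<in> {1..p} \<Longrightarrow> x j \<in> {1, -1}"
  shows "let
      F = (\<lambda>n::nat.
        ((\<Prod>j=1..p. zeta_partial n (i j) (x j)) - zeta_partial n (\<Sum>j=1..p. i j) (\<Prod>j=1..p. x j))
          / ((of_nat n + of_nat r) * (of_nat n + of_nat k)));
      G = (\<lambda>(t::nat) n::nat.
        (\<Prod>a=1..p. x a ^ n) / (of_nat n ^ (\<Sum>a=1..p. i a) * (of_nat n + of_nat r + of_nat t - 1)));
      H = (\<lambda>(t::nat) n::nat.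
        \<Sum>j=0..p-1. \<Sum>l\<in>incr_tuples j p.
          (-1) ^ (p - j)
          * ((\<Prod>b=1..j. zeta_partial n (i (l b)) (x (l b)))
             / (of_nat n ^ ((\<Sum>a=1..p. i a) - (\<Sum>b=1..j. i (l b))) * (of_nat n + of_nat r + of_nat t - 1)))
          * ((\<Prod>a=1..p. x a ^ n) / (\<Prod>b=1..j. x (l b) ^ n)))
    in summable (\<lambda>n. F (Suc n))
       \<and> (\<forall>t\<in>{1..k-r}. summable (\<lambda>n. G t (Suc n)) \<and> summable (\<lambda>n. H t (Suc n)))
       \<and> (of_nat k - of_nat r) * (\<Sum>n. F (Suc n))
          = - (\<Sum>t=1..k-r. \<Sum>n. G t (Suc n)) - (\<Sum>t=1..k-r. \<Sum>n. H t (Suc n))"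
proof -
  define s where "s = (\<Sum>a=1..p. i a)"
  define Z where "Z = (\<lambda>j n. zeta_partial n (i j) (x j))"
  define a where "a = (\<lambda>j n. x j ^ n / of_nat n ^ i j)"
  define D where "D = (\<lambda>n. (\<Prod>j=1..p. Z j n) - zeta_partial n s (\<Prod>j=1..p. x j))"
  define u where "u = (\<lambda>(t::nat) (n::nat). 1 / (of_nat n + of_nat r + of_nat t - 1 :: complex))"
  define F where "F = (\<lambda>n. D n / ((of_nat n + of_nat r) * (of_nat n + of_nat k)))"
  define G where "G = (\<lambda>(t::nat) n::nat.
    (\<Prod>a=1..p. x a ^ n) / (of_nat n ^ s * (of_nat n + of_nat r + of_nat t - 1)))"
  define H where "H = (\<lambda>(t::nat) n::nat.
        \<Sum>j=0..p-1. \<Sum>l\<in>incr_tuples j p.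
          (-1) ^ (p - j)
          * ((\<Prod>b=1..j. Z (l b) n)
             / (of_nat n ^ (s - (\<Sum>b=1..j. i (l b))) * (of_nat n + of_nat r + of_nat t - 1)))
          * ((\<Prod>a=1..p. x a ^ n) / (\<Prod>b=1..j. x (l b) ^ n)))"
  have x0: "x j \<noteq> 0" and nx: "norm (x j) = 1" if "j \<in> {1..p}" for j
    using assms(5)[OF that] by auto
  have s1: "1 \<le> s"
    using assms(2,3) member_le_sum[of 1 "{1..p}" i] by (force simp: s_def)
  \<comment> \<open>As \<open>1 \<le> p\<close>, the product has a vanishing factor; this removes
    the lower boundary term.\<close>
  have D0: "D 0 = 0" using assms(2) by (simp add: D_def Z_def prod_zero_iff)

  have den: "(of_nat (Suc n) + of_nat r + of_nat t - 1 :: complex) = of_nat (n + r + t)" for n t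
    by simp

  \<comment> \<open>The increments of \<open>D\<close>\<close>
  have H_eq: "H t n = u t n * ((\<Prod>j=1..p. Z j n - a j n) - (\<Prod>j=1..p. Z j n))" for t n
  proof -
    have "(-1) ^ (p - j)
          * ((\<Prod>b=1..j. Z (l b) n)
             / (of_nat n ^ (s - (\<Sum>b=1..j. i (l b))) * (of_nat n + of_nat r + of_nat t - 1)))
          * ((\<Prod>a=1..p. x a ^ n) / (\<Prod>b=1..j. x (l b) ^ n))
        = u t n * ((-1) ^ (p - j) * (\<Prod>b\<in>l ` {1..j}. Z b n) * (\<Prod>b\<in>{1..p} - l ` {1..j}. a b n))"
      if l: "l \<in> incr_tuples j p" for j l
    proof -
      define S where "S = l ` {1..j}"
      have inj: "inj_on l {1..j}" using l by (rule incr_tuples_inj_on)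
      have S: "S \<subseteq> {1..p}" using l by (auto simp: S_def incr_tuples_def)
      have fS: "finite S" by (simp add: S_def)
      have 1: "(\<Prod>b=1..j. Z (l b) n) = (\<Prod>b\<in>S. Z b n)"
        by (simp only: S_def prod.reindex[OF inj] o_def)
      have 2: "(\<Sum>b=1..j. i (l b)) = sum i S"
        by (simp only: S_def sum.reindex[OF inj] o_def)
      have 3: "(\<Prod>b=1..j. x (l b) ^ n) = (\<Prod>b\<in>S. x b ^ n)"
        by (simp only: S_def prod.reindex[OF inj] o_def)
      \<comment> \<open>The natural subtraction is exact, since \<open>sum i S\<close> is part of
        the total \<open>s\<close>.\<close>
      have 4: "s - sum i S = sum i ({1..p} - S)"
        using sum.subset_diff[OF S, of i] by (simp add: s_def)
      have 5: "(\<Prod>a=1..p. x a ^ n) / (\<Prod>b\<in>S. x b ^ n) = (\<Prod>b\<in>{1..p} - S. x b ^ n)"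
      proof -
        have "(\<Prod>b\<in>S. x b ^ n) \<noteq> 0" using S x0 fS by (auto simp: prod_zero_iff)
        thus ?thesis using prod.subset_diff[OF S, of "\<lambda>a. x a ^ n"] by simp
      qed
      have 6: "(\<Prod>b\<in>{1..p} - S. a b n)
          = (\<Prod>b\<in>{1..p} - S. x b ^ n) / of_nat n ^ sum i ({1..p} - S)"
        by (simp add: a_def prod_dividef power_sum)
      show ?thesis
        unfolding 1 2 3 4 5 S_def[symmetric] 6 u_def by simp
    qed
    thus ?thesis
      unfolding H_def prod_diff_incr_tuples[OF assms(2)] sum_distrib_left
      by (intro sum.cong refl) auto
  qed
  \<comment> \<open>Passing from \<open>Suc n\<close> back to \<open>n\<close> subtracts
    \<open>a\<close> from each \<open>Z\<close>: this change of the product gives \<open>H\<close>,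
    and the last term of the single zeta sum gives \<open>G\<close>.\<close>
  have step: "(D (Suc n) - D n) * u t (Suc n) = - (G t (Suc n) + H t (Suc n))" for t n
  proof -
    have "Z j n = Z j (Suc n) - a j (Suc n)" for j
      by (simp add: Z_def a_def zeta_partial_Suc del: of_nat_Suc)
    hence "(\<Prod>j=1..p. Z j n) = (\<Prod>j=1..p. Z j (Suc n) - a j (Suc n))"
      by simp
    moreover have "G t (Suc n) = u t (Suc n) * ((\<Prod>j=1..p. x j) ^ Suc n / of_nat (Suc n) ^ s)"
      unfolding G_def u_def prod_power_distrib by simp
    ultimately show ?thesis
      unfolding H_eq D_def zeta_partial_Suc
      by (simp add: algebra_simps del: of_nat_Suc power_Suc)
  qed

  \<comment> \<open>Growth of \<open>D\<close> and convergence of the series\<close>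
  have D_bigo: "D \<in> O(\<lambda>n. of_real (real n powr (1/2)))"
  proof -
    have "Z j \<in> O(\<lambda>n. of_real (ln (real n)))" if "j \<in> {1..p}" for j
      unfolding Z_def using nx[OF that] assms(3)[OF that] by (intro zeta_partial_bigo_ln) simp_all
    hence "(\<lambda>n. \<Prod>j=1..p. Z j n) \<in> O(\<lambda>n. \<Prod>j=1..p. of_real (ln (real n)))"
      by (rule landau_o.big_prod)
    hence "(\<lambda>n. \<Prod>j=1..p. Z j n) \<in> O(\<lambda>n. of_real (ln (real n) ^ p))"
      by simp
    \<comment> \<open>The exponent 1/2 represents any number strictly between 0 and 1: it beats all
      powers of the logarithm, yet leaves room for decay against \<open>1/n\<close> and summability
      against \<open>1/n^2\<close>.\<close>
    also have "(\<lambda>n. of_real (ln (real n) ^ p)) \<in> O(\<lambda>n. of_real (real n powr (1/2)) :: complex)"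
      unfolding landau_o.big.of_real_iff by real_asymp
    finally have 1: "(\<lambda>n. \<Prod>j=1..p. Z j n) \<in> O(\<lambda>n. of_real (real n powr (1/2)))" .
    have "norm (\<Prod>j=1..p. x j) = 1" by (simp add: prod_norm[symmetric] nx)
    hence "(\<lambda>n. zeta_partial n s (\<Prod>j=1..p. x j)) \<in> O(\<lambda>n. of_real (ln (real n)))"
      using s1 by (intro zeta_partial_bigo_ln) auto
    also have "(\<lambda>n. of_real (ln (real n))) \<in> O(\<lambda>n. of_real (real n powr (1/2)) :: complex)"
      unfolding landau_o.big.of_real_iff by real_asymp
    finally show ?thesis unfolding D_def using 1 by (intro sum_in_bigo)
  qed

  \<comment> \<open>This form lets the estimates be made over the reals. As
    \<open>1 \<le> t\<close>, the natural subtraction is exact.\<close>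
  have u_real: "u t n = of_real (1 / (real n + real (r + t - 1)))" if "1 \<le> t" for t n
    using that by (simp add: u_def of_nat_diff algebra_simps)
  have summ: "summable (\<lambda>n. D (Suc n) * (u t (Suc n) - u t (Suc (Suc n))))" if t: "1 \<le> t" for t
  proof -
    have "(\<lambda>n. 1 / (real n + c) - 1 / (real (Suc n) + c)) \<in> O(\<lambda>n. real n powr (- 2))" for c
      by real_asymp
    hence "(\<lambda>n. u t n - u t (Suc n)) \<in> O(\<lambda>n. of_real (real n powr (- 2)))"
      unfolding u_real[OF t] of_real_diff[symmetric] landau_o.big.of_real_iff .
    from landau_o.big.mult[OF D_bigo this]
    have "(\<lambda>n. D n * (u t n - u t (Suc n)))
        \<in> O(\<lambda>n. of_real (real n powr (1/2) * real n powr (- 2)))"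
      by simp
    hence "(\<lambda>n. norm (D n * (u t n - u t (Suc n)))) \<in> O(\<lambda>n. real n powr (- (3/2)))"
      by (simp add: powr_add[symmetric] bigo_def norm_mult)
    hence "summable (\<lambda>n. norm (D n * (u t n - u t (Suc n))))"
      by (rule summable_comparison_test_bigo[rotated]) (simp add: summable_real_powr_iff)
    from summable_norm_cancel[OF this] show ?thesis
      by (subst summable_Suc_iff)
  qed
  have lim: "(\<lambda>N. D N * u t (Suc N)) \<longlonglongrightarrow> 0" if t: "1 \<le> t" for t
  proof -
    have "(\<lambda>n. 1 / (real (Suc n) + c)) \<in> O(\<lambda>n. real n powr (- 1))" for c
      by real_asymp
    hence "(\<lambda>n. u t (Suc n)) \<in> O(\<lambda>n. of_real (real n powr (- 1)))"
      unfolding u_real[OF t] landau_o.big.of_real_iff .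
    from landau_o.big.mult[OF D_bigo this]
    have "(\<lambda>n. D n * u t (Suc n)) \<in> O(\<lambda>n. of_real (real n powr (1/2) * real n powr (- 1)))"
      by simp
    also have "(\<lambda>n. of_real (real n powr (1/2) * real n powr (- 1)) :: complex) \<in> o(\<lambda>n. of_real 1)"
      unfolding landau_o.small.of_real_iff by real_asymp
    finally show ?thesis by (auto dest: smalloD_tendsto)
  qed

  \<comment> \<open>\<open>E t\<close> links the two sides: summation by parts makes it minus the
    sum of \<open>G t + H t\<close>, and adding over \<open>t\<close> gives the left side.\<close>
  define E where "E = (\<lambda>t. \<Sum>n. D (Suc n) * (u t (Suc n) - u t (Suc (Suc n))))"
  have GH: "(\<lambda>n. G t (Suc n) + H t (Suc n)) sums (- E t)" if "1 \<le> t" for t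
    using sums_minus[OF sums_by_parts[OF D0 lim[OF that] summ[OF that]]]
    by (simp only: step E_def minus_minus)
  have G_summable: "summable (\<lambda>n. G t (Suc n))" if t: "1 \<le> t" for t
  proof (rule summable_comparison_test')
    show "summable (\<lambda>n. 1 / real (Suc n) ^ 2)"
      using inverse_power_summable[of 2, where 'a = real]
      by (subst summable_Suc_iff) (simp add: inverse_eq_divide)
    fix n :: nat
    have "norm (G t (Suc n)) = 1 / (real (Suc n) ^ s * real (n + r + t))"
      unfolding G_def den by (simp add: norm_divide norm_mult norm_power prod_norm[symmetric] nx
          del: of_nat_Suc of_nat_add)
    \<comment> \<open>Here \<open>1 \<le> s\<close> and \<open>1 \<le> t\<close> each contribute one
      factor \<open>Suc n\<close>.\<close>
    also have "\<dots> \<le> 1 / (real (Suc n) ^ 1 * real (Suc n))"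
      using s1 t by (intro divide_left_mono mult_mono power_increasing mult_pos_pos) auto
    finally show "norm (G t (Suc n)) \<le> 1 / real (Suc n) ^ 2"
      by (simp add: power2_eq_square)
  qed
  have H_summable: "summable (\<lambda>n. H t (Suc n))" if "1 \<le> t" for t
    using summable_diff[OF sums_summable[OF GH[OF that]] G_summable[OF that]] by simp
  have E_eq: "E t = - (\<Sum>n. G t (Suc n)) - (\<Sum>n. H t (Suc n))" if "1 \<le> t" for t
  proof -
    have "- E t = (\<Sum>n. G t (Suc n)) + (\<Sum>n. H t (Suc n))"
      unfolding suminf_add[OF G_summable[OF that] H_summable[OF that]]
      by (rule sums_unique[OF GH[OF that]])
    thus ?thesis by (metis add.inverse_inverse minus_add_distrib diff_conv_add_uminus)
  qed

  \<comment> \<open>Telescoping over \<open>t\<close> and the final identity\<close>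
  have tele: "(\<Sum>t=1..m. u t (Suc n) - u t (Suc (Suc n))) = u 1 (Suc n) - u (Suc m) (Suc n)" for m n
  proof -
    \<comment> \<open>\<open>u\<close> depends only on \<open>n + t\<close>, so a step in
      \<open>n\<close> is a step in \<open>t\<close>.\<close>
    have "u t (Suc (Suc n)) = u (Suc t) (Suc n)" for t by (simp add: u_def)
    thus ?thesis by (induction m) auto
  qed
  have F_eq: "(of_nat k - of_nat r) * F (Suc n)
      = (\<Sum>t=1..k-r. D (Suc n) * (u t (Suc n) - u t (Suc (Suc n))))" for n
  proof -
    have partial_fraction: "(K - R) * (d / ((m + R) * (m + K))) = d * (1 / (m + R) - 1 / (m + K))"
      if "m + R \<noteq> 0" "m + K \<noteq> 0" for K R d m :: complex
      using that by (simp add: divide_simps)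
    \<comment> \<open>The shift by -1 in \<open>u\<close> turns the end indices \<open>1\<close> and
      \<open>Suc (k - r)\<close> into the offsets \<open>r\<close> and \<open>k\<close>.\<close>
    have "u (Suc (k - r)) (Suc n) = 1 / (of_nat (Suc n) + of_nat k)"
      "u 1 (Suc n) = 1 / (of_nat (Suc n) + of_nat r)"
      using assms(1) by (simp_all add: u_def of_nat_diff)
    moreover have nz: "(of_nat (Suc n) + of_nat c :: complex) \<noteq> 0" for c
      unfolding of_nat_add[symmetric] of_nat_eq_0_iff by simp
    ultimately show ?thesis
      unfolding sum_distrib_left[symmetric] tele F_def by (simp only: partial_fraction[OF nz nz])
  qed
  have F_sums: "(\<lambda>n. (of_nat k - of_nat r) * F (Suc n)) sums (\<Sum>t=1..k-r. E t)"
    unfolding F_eq E_def by (intro sums_sum summable_sums summ) auto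
  have kr: "(of_nat k - of_nat r :: complex) \<noteq> 0" using assms(1) by simp
  have F_summable: "summable (\<lambda>n. F (Suc n))"
    using sums_summable[OF F_sums] kr by (simp add: summable_cmult_iff)
  have "(of_nat k - of_nat r) * (\<Sum>n. F (Suc n)) = (\<Sum>t=1..k-r. E t)"
    using sums_unique[OF F_sums] suminf_mult[OF F_summable] by simp
  also have "\<dots> = - (\<Sum>t=1..k-r. \<Sum>n. G t (Suc n)) - (\<Sum>t=1..k-r. \<Sum>n. H t (Suc n))"
    by (simp add: E_eq sum_subtractf sum_negf)
  finally show ?thesis
    using F_summable G_summable H_summable
    unfolding Let_def F_def G_def H_def D_def Z_def s_def by auto
qed

end
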